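(* For $n\geq 2$, the number $\kappa_n$ of kernel positions of rank $n$ in the flat Bernoulli game is $$\kappa_n=\sum_{k=0}^{\lfloor (n-3)/2\rfloor}\ \sum_{\substack{1=i_0<i_1<\cdots<i_{k+1}=n\\ i_{j+1}-i_j\ge 2\ \text{for all } j}}\ \prod_{j=0}^k (i_{j+1}-i_j-2)!\binom{i_{j+1}}{i_j}.$$
   Context: The flat Bernoulli game: positions of rank $n\ge0$ are words $u_1\cdots u_n$ of positive integers with $1\le u_i\le i$ for all $i$. A valid move replaces $u_1\cdots u_n$ by $u_1\cdots u_m$ for some $1\le m<n$ such that $u_{m+1}<u_j$ for all $j>m+1$. Players alternate; a player unable to move loses; kernel positions are positions of Grundy number zero (every valid move from them leads to a non-kernel position). *)

theory Defs
  imports Complex_Main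
begin

text \<open>
  A word \<open>u\<^sub>1 \<dots> u\<^sub>n\<close> is a list; since lists are indexed from 0, the letter \<open>u\<^sub>i\<close> is
  \<^term>\<open>u ! (i - 1)\<close>.
\<close>

definition fb_positions :: "nat \<Rightarrow> nat list set" where
  "fb_positions n =
     {u. length u = n \<and> (\<forall>i\<in>{1..n}. 1 \<le> u ! (i - 1) \<and> u ! (i - 1) \<le> i)}"

text \<open>The letter \<open>u\<^bsub>m+1\<^esub>\<close> is \<^term>\<open>u ! m\<close>.\<close>

definition fb_move :: "nat list \<Rightarrow> nat list \<Rightarrow> bool" where
  "fb_move u v \<longleftrightarrow>
     (\<exists>m. 1 \<le> m \<and> m < length u \<and> v = take m u \<and>
          (\<forall>j\<in>{m + 2..length u}. u ! m < u ! (j - 1)))"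

lemma fb_move_length: "fb_move u v \<Longrightarrow> length v < length u"
  by (auto simp: fb_move_def)

lemma fb_move_positions:
  assumes "u \<in> fb_positions n" "fb_move u v"
  shows "v \<in> fb_positions (length v)"
  using assms by (auto simp: fb_move_def fb_positions_def)

definition mex :: "nat set \<Rightarrow> nat" where
  "mex S = (LEAST g. g \<notin> S)"

function fb_grundy :: "nat list \<Rightarrow> nat" where
  "fb_grundy u = mex (fb_grundy ` {v. fb_move u v})"
  by pat_completeness auto
termination
  by (relation "measure length") (auto dest: fb_move_length)

declare fb_grundy.simps [simp del]

definition fb_kernel :: "nat \<Rightarrow> nat list set" where
  "fb_kernel n = {u \<in> fb_positions n. fb_grundy u = 0}"

definition kappa :: "nat \<Rightarrow> nat" where
  "kappa n = card (fb_kernel n)"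

lemma finite_fb_positions: "finite (fb_positions n)"
proof (rule finite_subset)
  show "fb_positions n \<subseteq> {u. set u \<subseteq> {..n} \<and> length u = n}"
  proof
    fix u assume u: "u \<in> fb_positions n"
    have "u ! i \<le> n" if "i < n" for i
    proof -
      have "Suc i \<in> {1..n}" using that by auto
      then have "u ! (Suc i - 1) \<le> Suc i" using u unfolding fb_positions_def by blast
      then show ?thesis using that by simp
    qed
    then show "u \<in> {u. set u \<subseteq> {..n} \<and> length u = n}"
      using u by (auto simp: fb_positions_def in_set_conv_nth)
  qed
  show "finite {u. set u \<subseteq> {..n} \<and> length u = n}"
    by (rule finite_lists_length_eq) simp
qed

lemma finite_fb_kernel: "finite (fb_kernel n)"
  unfolding fb_kernel_def using finite_fb_positions by simp

lemma finite_fb_moves: "finite {v. fb_move u v}"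
  by (rule finite_subset[of _ "(\<lambda>m. take m u) ` {..length u}"]) (auto simp: fb_move_def)

lemma fb_grundy_eq_0_iff: "fb_grundy u = 0 \<longleftrightarrow> (\<forall>v. fb_move u v \<longrightarrow> fb_grundy v \<noteq> 0)"
proof -
  let ?S = "fb_grundy ` {v. fb_move u v}"
  have "\<exists>g. g \<notin> ?S"
    using ex_new_if_finite[OF infinite_UNIV_nat finite_imageI[OF finite_fb_moves]] by blast
  then have "mex ?S \<notin> ?S" unfolding mex_def by (metis (lifting) LeastI_ex)
  moreover have "0 \<notin> ?S \<Longrightarrow> mex ?S = 0"
    unfolding mex_def by (metis (lifting) Least_le le_zero_eq)
  ultimately have "mex ?S = 0 \<longleftrightarrow> 0 \<notin> ?S" by metis
  then show ?thesis by (subst fb_grundy.simps) auto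
qed

text \<open>A chain \<open>i\<^sub>0 < \<dots> < i\<^bsub>k+1\<^esub>\<close> is a list of length \<^term>\<open>k + 2\<close>.\<close>

definition gap2_chains :: "nat \<Rightarrow> nat \<Rightarrow> nat list set" where
  "gap2_chains n k =
     {i. length i = k + 2 \<and> sorted_wrt (<) i \<and> i ! 0 = 1 \<and> i ! (k + 1) = n \<and>
         (\<forall>j\<in>{0..k}. i ! (j + 1) - i ! j \<ge> 2)}"

lemma finite_gap2_chains: "finite (gap2_chains n k)"
proof (rule finite_subset)
  show "gap2_chains n k \<subseteq> {i. set i \<subseteq> {..n} \<and> length i = k + 2}"
  proof
    fix i assume i: "i \<in> gap2_chains n k"
    have "i ! j \<le> n" if "j < k + 2" for j
    proof (cases "j = k + 1")
      case False
      then have "i ! j < i ! (k + 1)"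
        using i that by (auto simp: gap2_chains_def intro: sorted_wrt_nth_less)
      then show ?thesis using i by (simp add: gap2_chains_def)
    qed (use i in \<open>simp add: gap2_chains_def\<close>)
    then show "i \<in> {i. set i \<subseteq> {..n} \<and> length i = k + 2}"
      using i by (auto simp: gap2_chains_def in_set_conv_nth)
  qed
  show "finite {i. set i \<subseteq> {..n} \<and> length i = k + 2}"
    by (rule finite_lists_length_eq) simp
qed

end

theory Submission
  imports Defs
begin

text \<open>
  Let \<open>i\<close> be the rank of the longest proper prefix of a kernel position \<open>u\<close> of rank \<open>n \<ge> 2\<close>
  that is itself in the kernel.  Since that prefix admits no move to a shorter kernel prefix,
  neither does any of its extensions; hence the intermediate prefixes of \<open>u\<close> lie outside the kernel
  exactly because they can move to rank \<open>i\<close>, and \<open>u\<close> lies in it exactly because it cannot.  This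
  says that \<open>u\<^bsub>i+1\<^esub>\<close> is smaller than each of \<open>u\<^bsub>i+2\<^esub>, \<dots>, u\<^bsub>n-1\<^esub>\<close> but not smaller than \<open>u\<^sub>n\<close>.
  Summing over the value of \<open>u\<^bsub>i+1\<^esub>\<close>, every kernel position of rank \<open>i \<le> n - 2\<close> has
  \<open>(n - i - 2)! * (n choose i)\<close> such extensions, and iterating the resulting recurrence gives the
  sum over chains.
\<close>

section \<open>Counting lists letter by letter, and two binomial identities\<close>

lemma card_lists_nth_in:
  "card {xs. length xs = n \<and> (\<forall>j<n. xs ! j \<in> A j)} = (\<Prod>j<n. card (A j))"
proof (induction n)
  case 0
  have "{xs. length xs = 0 \<and> (\<forall>j<0. xs ! j \<in> A j)} = {[]}" by auto
  then show ?case by simp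
next
  case (Suc n)
  let ?L = "\<lambda>n. {xs. length xs = n \<and> (\<forall>j<n. xs ! j \<in> A j)}"
  have "bij_betw (\<lambda>(xs, x). xs @ [x]) (?L n \<times> A n) (?L (Suc n))"
    unfolding bij_betw_def
  proof
    show "inj_on (\<lambda>(xs, x). xs @ [x]) (?L n \<times> A n)" by (auto simp: inj_on_def)
    show "(\<lambda>(xs, x). xs @ [x]) ` (?L n \<times> A n) = ?L (Suc n)"
    proof (intro equalityI subsetI)
      fix ys assume "ys \<in> (\<lambda>(xs, x). xs @ [x]) ` (?L n \<times> A n)"
      then show "ys \<in> ?L (Suc n)" by (auto simp: nth_append less_Suc_eq)
    next
      fix ys assume ys: "ys \<in> ?L (Suc n)"
      then have "ys = take n ys @ [ys ! n]"
        using take_Suc_conv_app_nth[of n ys] by simp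
      moreover have "take n ys \<in> ?L n" "ys ! n \<in> A n" using ys by auto
      ultimately show "ys \<in> (\<lambda>(xs, x). xs @ [x]) ` (?L n \<times> A n)"
        by (intro image_eqI[of _ _ "(take n ys, ys ! n)"]) simp_all
    qed
  qed
  from bij_betw_same_card[OF this] show ?case
    using Suc by (simp add: card_cartesian_product)
qed

text \<open>The left side is the rising factorial (a+m)!/a!, extended one factor at a time by the
  absorption identity. It will count the middle letters of an extension, with \<open>a\<close> the
  distance from the first letter to its maximum.\<close>

lemma prod_shift_eq_fact_binomial:
  "(\<Prod>j=1..m. a + j) = fact m * ((a + m) choose m)" for a m :: nat
proof (induction m)
  case (Suc m)
  have "Suc m * (Suc (a + m) choose Suc m) = Suc (a + m) * ((a + m) choose m)"
    by (rule Suc_times_binomial)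
  moreover have "(\<Prod>j=1..Suc m. a + j) = fact m * (Suc (a + m) * ((a + m) choose m))"
    using Suc by (simp add: mult_ac)
  ultimately show ?case by (simp only: fact_Suc of_nat_id add_Suc_right mult_ac)
qed simp

text \<open>Shifting \<open>c\<close> by one in the sum for \<open>Suc i\<close> leaves the sum for
  \<open>i\<close> plus an ordinary hockey-stick sum, and Pascal's rule adds the two values.
  Combinatorially, the term for \<open>c\<close> counts the (m+2)-subsets of {1..i+m+2} whose second
  smallest element is c+1.\<close>

lemma weighted_hockey_stick:
  "(\<Sum>c=1..Suc i. c * ((Suc i - c + m) choose m)) = (i + m + 2) choose i"
proof (induction i)
  case (Suc i)
  have split: "(\<Sum>c=1..Suc (Suc i). c * ((Suc (Suc i) - c + m) choose m))
     = (\<Sum>c=0..Suc i. c * ((Suc i - c + m) choose m)) + (\<Sum>c=0..Suc i. (Suc i - c + m) choose m)"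
    using sum.shift_bounds_cl_Suc_ivl[of "\<lambda>c. c * ((Suc (Suc i) - c + m) choose m)" 0 "Suc i"]
    by (simp add: sum.distrib del: sum.cl_ivl_Suc)
  have first: "(\<Sum>c=0..Suc i. c * ((Suc i - c + m) choose m)) = (i + m + 2) choose i"
    using Suc by (simp add: sum.atLeast_Suc_atMost[of 0] del: sum.cl_ivl_Suc)
  have "(a + m) choose m = (m + a) choose a" for a
    using binomial_symmetric[of m "a + m"] by (simp add: add.commute)
  then have "(\<Sum>c=0..Suc i. (Suc i - c + m) choose m) = (\<Sum>a\<le>Suc i. (m + a) choose a)"
    by (intro sum.reindex_bij_witness[of _ "\<lambda>a. Suc i - a" "\<lambda>a. Suc i - a"])
      (simp_all del: add_Suc add_Suc_right Nat.add_diff_assoc2 Nat.add_diff_assoc)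
  also have "\<dots> = (i + m + 2) choose Suc i"
    using sum_choose_lower[of m "Suc i"] by (simp add: add.commute)
  finally show ?case using split first by simp
qed simp

section \<open>Moves between prefixes and kernel membership\<close>

lemma fb_positions_iff:
  "u \<in> fb_positions n \<longleftrightarrow> length u = n \<and> (\<forall>j<n. u ! j \<in> {1..Suc j})"
proof -
  have "{1..n} = Suc ` {..<n}" by (simp add: image_Suc_lessThan)
  then show ?thesis by (auto simp: fb_positions_def)
qed

text \<open>The condition is phrased with letters of the whole word \<open>u\<close>, in 0-based
  indices, so that moves from different prefixes of \<open>u\<close> to rank \<open>i\<close> can be
  compared.\<close>

lemma fb_move_take_iff:
  assumes "1 \<le> i" "i < l" "l \<le> length u"
  shows "fb_move (take l u) (take i u) \<longleftrightarrow> (\<forall>j. i < j \<and> j < l \<longrightarrow> u ! i < u ! j)"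
proof -
  have "fb_move (take l u) (take i u) \<longleftrightarrow> (\<forall>j\<in>{i + 2..l}. u ! i < u ! (j - 1))"
    (is "?L \<longleftrightarrow> ?R")
  proof
    assume ?L
    then obtain m where m: "m < l" "take i u = take m (take l u)"
      "\<forall>j\<in>{m + 2..l}. take l u ! m < take l u ! (j - 1)"
      using assms by (auto simp: fb_move_def)
    then have "length (take i u) = length (take m (take l u))" by simp
    then have "m = i" using m(1) assms by simp
    then show ?R using m(3) assms by (fastforce simp: nth_take)
  next
    assume ?R
    then show ?L using assms unfolding fb_move_def by (intro exI[of _ i]) auto
  qed
  also have "\<dots> \<longleftrightarrow> (\<forall>j. i < j \<and> j < l \<longrightarrow> u ! i < u ! j)"
  proof (intro iffI allI ballI impI; (elim conjE)?)
    fix j assume "\<forall>j\<in>{i + 2..l}. u ! i < u ! (j - 1)" "i < j" "j < l"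
    then show "u ! i < u ! j" by (auto dest!: bspec[of _ _ "Suc j"])
  next
    fix j assume "\<forall>j. i < j \<and> j < l \<longrightarrow> u ! i < u ! j" "j \<in> {i + 2..l}"
    then show "u ! i < u ! (j - 1)" by (auto dest!: spec[of _ "j - 1"])
  qed
  finally show ?thesis .
qed

text \<open>Shortening the source only drops inequalities. Contrapositively, a prefix without a move
  to rank \<open>i\<close> passes this on to its extensions.\<close>

lemma fb_move_take_mono:
  assumes "fb_move (take l u) (take i u)" "1 \<le> i" "i < k" "k \<le> l" "l \<le> length u"
  shows "fb_move (take k u) (take i u)"
  using assms by (simp add: fb_move_take_iff)

lemma fb_grundy_take_eq_0_iff:
  assumes "l \<le> length u"
  shows "fb_grundy (take l u) = 0 \<longleftrightarrow>
    (\<forall>m. 1 \<le> m \<and> m < l \<and> fb_move (take l u) (take m u) \<longrightarrow> fb_grundy (take m u) \<noteq> 0)"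
proof -
  have "\<exists>m. 1 \<le> m \<and> m < l \<and> v = take m u" if move: "fb_move (take l u) v" for v
  proof -
    obtain m where "1 \<le> m" "m < length (take l u)" "v = take m (take l u)"
      using move unfolding fb_move_def by blast
    then show ?thesis using assms by (intro exI[of _ m]) simp
  qed
  then show ?thesis by (subst fb_grundy_eq_0_iff) metis
qed

text \<open>Only rank \<open>i\<close> can decide. Ranks strictly between \<open>i\<close> and
  \<open>l\<close> are non-kernel by assumption, and a move to a kernel prefix below rank
  \<open>i\<close> would, by \<open>fb_move_take_mono\<close>, already exist from the kernel prefix
  of rank \<open>i\<close>.\<close>

lemma fb_grundy_eq_0_iff_not_move_to_last:
  assumes "1 \<le> i" "i < l" "l \<le> length u" "fb_grundy (take i u) = 0"
    and "\<And>m. i < m \<Longrightarrow> m < l \<Longrightarrow> fb_grundy (take m u) \<noteq> 0"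
  shows "fb_grundy (take l u) = 0 \<longleftrightarrow> \<not> fb_move (take l u) (take i u)"
proof -
  have "fb_grundy (take m u) \<noteq> 0"
    if m: "1 \<le> m" "m < l" "fb_move (take l u) (take m u)" "m \<noteq> i" for m
  proof (cases "i < m")
    case False
    then have "fb_move (take i u) (take m u)"
      using fb_move_take_mono[of l u m i] m assms by simp
    then show ?thesis using assms(4) fb_grundy_eq_0_iff by blast
  qed (use assms(5) m in blast)
  then show ?thesis
    using fb_grundy_take_eq_0_iff[OF assms(3)] assms(1,2,4) by blast
qed

text \<open>Intermediate prefixes must move to rank \<open>i\<close> and \<open>u\<close> must not,
  so the comparison with \<open>u ! i\<close> fails at the last letter and nowhere before. If
  \<open>u\<close> had only one letter after rank \<open>i\<close>, the move condition would be
  vacuous and the move valid; hence \<open>i + 2\<close> in the bound.\<close>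

lemma fb_last_kernel_prefix_iff:
  assumes "1 \<le> i" "i < length u" "fb_grundy (take i u) = 0"
  shows "(\<forall>l. i < l \<and> l < length u \<longrightarrow> fb_grundy (take l u) \<noteq> 0) \<and> fb_grundy u = 0 \<longleftrightarrow>
    i + 2 \<le> length u \<and> (\<forall>j. i < j \<and> j < length u - 1 \<longrightarrow> u ! i < u ! j)
      \<and> u ! (length u - 1) \<le> u ! i"
    (is "?A \<and> ?K \<longleftrightarrow> ?R")
proof -
  let ?n = "length u"
  have A: "?A \<longleftrightarrow> (\<forall>l. i < l \<and> l < ?n \<longrightarrow> fb_move (take l u) (take i u))"
  proof
    assume ?A
    then show "\<forall>l. i < l \<and> l < ?n \<longrightarrow> fb_move (take l u) (take i u)"
      using fb_grundy_eq_0_iff_not_move_to_last[OF assms(1) _ _ assms(3)]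
      by (metis less_imp_le order.strict_trans)
  next
    assume "\<forall>l. i < l \<and> l < ?n \<longrightarrow> fb_move (take l u) (take i u)"
    then show ?A using assms(3) fb_grundy_eq_0_iff by blast
  qed
  have "?A \<Longrightarrow> ?K \<longleftrightarrow> \<not> fb_move (take ?n u) (take i u)"
    using fb_grundy_eq_0_iff_not_move_to_last[OF assms(1,2) _ assms(3)] by simp
  then have "?A \<and> ?K \<longleftrightarrow> (\<forall>l. i < l \<and> l < ?n \<longrightarrow> (\<forall>j. i < j \<and> j < l \<longrightarrow> u ! i < u ! j))
     \<and> \<not> (\<forall>j. i < j \<and> j < ?n \<longrightarrow> u ! i < u ! j)"
    using A fb_move_take_iff[OF assms(1)] assms(2) by (auto simp del: take_all)
  also have "\<dots> \<longleftrightarrow> ?R" (is "?P \<and> \<not> ?Q \<longleftrightarrow> _")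
  proof
    assume PQ: "?P \<and> \<not> ?Q"
    then obtain j where j: "i < j" "j < ?n" "u ! j \<le> u ! i" by (auto simp: not_less)
    \<comment> \<open>The case l = ?n - 1 of \<open>?P\<close> yields every comparison except the
      last one, so the failing index \<open>j\<close> must be \<open>?n - 1\<close>.\<close>
    have *: "u ! i < u ! j'" if "i < j'" "j' < ?n - 1" for j'
      using that conjunct1[OF PQ, rule_format, of "?n - 1" j'] by simp
    then have "j = ?n - 1" using *[of j] j by linarith
    then show ?R using * j by auto
  next
    assume R: ?R
    then have "\<not> ?Q" by (auto intro!: exI[of _ "?n - 1"] simp: not_less)
    then show "?P \<and> \<not> ?Q" using R by auto
  qed
  finally show ?thesis .
qed

section \<open>Extensions of a kernel prefix\<close>

text \<open>Possible suffixes after a longest proper kernel prefix of rank \<open>i\<close>, for i +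
  2 <= n. The entry \<open>e ! j\<close> is the letter of 1-based index i + j + 1, which explains
  its upper bound.\<close>

definition fb_ext :: "nat \<Rightarrow> nat \<Rightarrow> nat list set" where
  "fb_ext n i = {e. length e = n - i \<and> (\<forall>j<n - i. e ! j \<in> {1..Suc (i + j)}) \<and>
     (\<forall>j. 0 < j \<and> j < n - i - 1 \<longrightarrow> e ! 0 < e ! j) \<and> e ! (n - i - 1) \<le> e ! 0}"

text \<open>Classifies kernel positions by the rank of their longest proper kernel prefix.\<close>

definition fb_kernel_via :: "nat \<Rightarrow> nat \<Rightarrow> nat list set" where
  "fb_kernel_via n i = {u \<in> fb_kernel n. take i u \<in> fb_kernel i \<and>
     (\<forall>l. i < l \<and> l < n \<longrightarrow> fb_grundy (take l u) \<noteq> 0)}"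

text \<open>Once \<open>v\<close> is in the kernel, the criterion of
  \<open>fb_last_kernel_prefix_iff\<close> involves only letters of \<open>e\<close>. Prefix and
  suffix are therefore chosen independently, which makes the count a product.\<close>

lemma append_fb_kernel_via_iff:
  assumes "1 \<le> i" "i + 2 \<le> n" "length v = i" "length e = n - i"
  shows "v @ e \<in> fb_kernel_via n i \<longleftrightarrow> v \<in> fb_kernel i \<and> e \<in> fb_ext n i"
proof -
  let ?u = "v @ e"
  have len: "length ?u = n" using assms by simp
  have nth: "?u ! (i + j) = e ! j" for j using assms by (simp add: nth_append)
  have all_shift: "(\<forall>j. i < j \<and> j < n - 1 \<longrightarrow> ?u ! i < ?u ! j) \<longleftrightarrow>
      (\<forall>j. 0 < j \<and> j < n - i - 1 \<longrightarrow> e ! 0 < e ! j)" (is "?l \<longleftrightarrow> ?r")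
  proof
    assume ?l
    then have "?u ! (i + 0) < ?u ! (i + j)" if "0 < j" "j < n - i - 1" for j using that by simp
    then show ?r unfolding nth by blast
  next
    assume r: ?r
    show ?l
    proof (intro allI impI)
      fix j assume "i < j \<and> j < n - 1"
      then show "?u ! i < ?u ! j"
        using r[rule_format, of "j - i"] nth[of 0] nth[of "j - i"] by auto
    qed
  qed
  have last: "?u ! (n - 1) = e ! (n - i - 1)" using nth[of "n - i - 1"] assms by simp
  have pos: "?u \<in> fb_positions n \<longleftrightarrow>
      v \<in> fb_positions i \<and> (\<forall>j<n - i. e ! j \<in> {1..Suc (i + j)})" (is "?p \<longleftrightarrow> ?q \<and> ?s")
  proof (intro iffI conjI)
    assume p: ?p
    show ?q unfolding fb_positions_iff
    proof (intro conjI allI impI)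
      fix j assume "j < i"
      then show "v ! j \<in> {1..Suc j}"
        using p assms unfolding fb_positions_iff by (auto simp: nth_append dest!: spec[of _ j])
    qed (use assms in simp)
    show ?s
    proof (intro allI impI)
      fix j assume "j < n - i"
      then show "e ! j \<in> {1..Suc (i + j)}"
        using p nth[of j] unfolding fb_positions_iff by (auto dest!: spec[of _ "i + j"])
    qed
  next
    assume qs: "?q \<and> ?s"
    show ?p unfolding fb_positions_iff
    proof (intro conjI allI impI)
      fix j assume "j < n"
      show "?u ! j \<in> {1..Suc j}"
      proof (cases "j < i")
        case True
        then show ?thesis using qs assms by (simp add: fb_positions_iff nth_append)
      next
        case False
        then show ?thesis
          using qs \<open>j < n\<close> nth[of "j - i"] by (auto dest!: spec[of _ "j - i"])
      qed
    qed (rule len)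
  qed
  show ?thesis
    using fb_last_kernel_prefix_iff[of i ?u] assms pos all_shift last nth[of 0]
    unfolding fb_kernel_via_def fb_kernel_def fb_ext_def len by auto
qed

lemma card_fb_kernel_via:
  assumes "1 \<le> i" "i + 2 \<le> n"
  shows "card (fb_kernel_via n i) = kappa i * card (fb_ext n i)"
proof -
  have lenK: "length v = i" if "v \<in> fb_kernel i" for v i
    using that by (simp add: fb_kernel_def fb_positions_def)
  have lenE: "length e = n - i" if "e \<in> fb_ext n i" for e
    using that by (simp add: fb_ext_def)
  have "bij_betw (\<lambda>(v, e). v @ e) (fb_kernel i \<times> fb_ext n i) (fb_kernel_via n i)"
    unfolding bij_betw_def
  proof
    show "inj_on (\<lambda>(v, e). v @ e) (fb_kernel i \<times> fb_ext n i)"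
      using lenK by (auto simp: inj_on_def append_eq_append_conv)
    show "(\<lambda>(v, e). v @ e) ` (fb_kernel i \<times> fb_ext n i) = fb_kernel_via n i"
    proof (intro equalityI subsetI)
      fix u assume "u \<in> (\<lambda>(v, e). v @ e) ` (fb_kernel i \<times> fb_ext n i)"
      then show "u \<in> fb_kernel_via n i"
        using append_fb_kernel_via_iff[OF assms] lenK lenE by auto
    next
      fix u assume u: "u \<in> fb_kernel_via n i"
      then have "length u = n" using lenK by (simp add: fb_kernel_via_def)
      then have "take i u \<in> fb_kernel i \<and> drop i u \<in> fb_ext n i"
        using append_fb_kernel_via_iff[OF assms, of "take i u" "drop i u"] u assms by simp
      then show "u \<in> (\<lambda>(v, e). v @ e) ` (fb_kernel i \<times> fb_ext n i)"
        by (intro image_eqI[of _ _ "(take i u, drop i u)"]) auto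
    qed
  qed
  from bij_betw_same_card[OF this] show ?thesis
    by (simp add: card_cartesian_product kappa_def)
qed

text \<open>Fix the first letter c. The middle letter at offset j lies above c and has (i + 1 - c) +
  j values, and the last letter has c values. The rising factorial and then the weighted
  hockey-stick sum over c give the count.\<close>

lemma card_fb_ext:
  assumes "i + 2 \<le> n"
  shows "card (fb_ext n i) = fact (n - i - 2) * (n choose i)"
proof -
  define m where "m = n - i - 2"
  have n: "n = i + m + 2" "n - i = Suc (Suc m)" using assms by (auto simp: m_def)
  \<comment> \<open>\<open>A c j\<close> holds the admissible letters at offset \<open>j\<close>
    when the first letter is \<open>c\<close>; offset \<open>Suc m\<close> is the last one.\<close>
  define A where "A c j = (if j = 0 then {c} else if j = Suc m then {1..c} else {Suc c..Suc (i + j)})"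
    for c j :: nat
  define L where "L c = {e. length e = Suc (Suc m) \<and> (\<forall>j<Suc (Suc m). e ! j \<in> A c j)}" for c
  have cardL: "card (L c) = fact m * (c * ((Suc i - c + m) choose m))" if "c \<in> {1..Suc i}" for c
  proof -
    have "card (L c) = (\<Prod>j<Suc (Suc m). card (A c j))"
      unfolding L_def by (rule card_lists_nth_in)
    also have "\<dots> = (\<Prod>j=1..m. card (A c j)) * c"
    proof -
      \<comment> \<open>Offset 0 contributes the factor 1 and is split off; the last offset
        contributes the factor \<open>c\<close>.\<close>
      have "(\<Prod>j<Suc m. card (A c j)) = (\<Prod>j<m. card (A c (Suc j)))"
        unfolding prod.lessThan_Suc_shift by (simp add: A_def)
      also have "\<dots> = (\<Prod>j=1..m. card (A c j))"
        by (rule prod.reindex_bij_witness[of _ "\<lambda>j. j - 1" Suc]) auto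
      finally show ?thesis by (simp add: A_def)
    qed
    also have "(\<Prod>j=1..m. card (A c j)) = (\<Prod>j=1..m. (Suc i - c) + j)"
      using that by (intro prod.cong) (auto simp: A_def)
    finally show ?thesis unfolding prod_shift_eq_fact_binomial by simp
  qed
  have nth0: "e ! 0 = c" if "e \<in> L c" for e c
    using that by (auto simp: L_def A_def dest!: spec[of _ "0::nat"])
  have "fb_ext n i = (\<Union>c\<in>{1..Suc i}. L c)"
  proof (intro equalityI subsetI)
    fix e assume e: "e \<in> fb_ext n i"
    then have "e ! 0 \<in> {1..Suc i}" by (auto simp: fb_ext_def n(2))
    moreover have "e ! j \<in> A (e ! 0) j" if "j < Suc (Suc m)" for j
      using e that by (auto simp: fb_ext_def n(2) A_def Suc_le_eq)
    ultimately show "e \<in> (\<Union>c\<in>{1..Suc i}. L c)"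
      using e by (intro UN_I[of "e ! 0"]) (auto simp: L_def fb_ext_def n(2))
  next
    fix e assume "e \<in> (\<Union>c\<in>{1..Suc i}. L c)"
    then obtain c where c: "c \<in> {1..Suc i}" "e \<in> L c" by blast
    have e: "length e = Suc (Suc m)" "\<And>j. j < Suc (Suc m) \<Longrightarrow> e ! j \<in> A c j"
      using c by (auto simp: L_def)
    have "e ! j \<in> {1..Suc (i + j)}" if "j < Suc (Suc m)" for j
      using e(2)[OF that] c(1) by (auto simp: A_def split: if_splits)
    moreover have "e ! 0 < e ! j" if "0 < j" "j < Suc m" for j
      using e(2)[of j] that nth0[OF c(2)] by (auto simp: A_def)
    moreover have "e ! Suc m \<le> e ! 0"
      using e(2)[of "Suc m"] nth0[OF c(2)] by (auto simp: A_def)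
    ultimately show "e \<in> fb_ext n i" using e(1) by (auto simp: fb_ext_def n(2))
  qed
  moreover have "card (\<Union>c\<in>{1..Suc i}. L c) = (\<Sum>c=1..Suc i. card (L c))"
  proof (rule card_UN_disjoint)
    \<comment> \<open>Finiteness is read off from the cardinality formula, whose value is
      positive.\<close>
    have "finite (L c)" if "c \<in> {1..Suc i}" for c
    proof (rule card_ge_0_finite)
      have "0 < (Suc i - c + m) choose m" by (simp only: zero_less_binomial_iff le_add2)
      then show "0 < card (L c)" using that unfolding cardL[OF that]
        by (auto simp only: atLeastAtMost_iff nat_0_less_mult_iff fact_gt_zero)
    qed
    then show "\<forall>c\<in>{1..Suc i}. finite (L c)" by blast
    show "\<forall>c\<in>{1..Suc i}. \<forall>d\<in>{1..Suc i}. c \<noteq> d \<longrightarrow> L c \<inter> L d = {}"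
      using nth0 by blast
  qed simp
  ultimately have "card (fb_ext n i) = fact m * (\<Sum>c=1..Suc i. c * ((Suc i - c + m) choose m))"
    using cardL by (simp add: sum_distrib_left del: sum.cl_ivl_Suc)
  then show ?thesis
    unfolding weighted_hockey_stick n(1)[symmetric] by (simp only: m_def)
qed

section \<open>Recurrence for the number of kernel positions\<close>

lemma fb_kernel_1: "fb_kernel 1 = {[1]}"
proof -
  have "fb_grundy [1] = 0" by (subst fb_grundy_eq_0_iff) (auto simp: fb_move_def)
  then show ?thesis by (auto simp: fb_kernel_def fb_positions_iff length_Suc_conv)
qed

text \<open>Every position of rank at least 2 has the kernel prefix \<open>[1]\<close>, so a longest
  proper kernel prefix exists. Its rank partitions the kernel into the classes counted by
  \<open>card_fb_kernel_via\<close>.\<close>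

lemma kappa_rec:
  assumes "n \<ge> 2"
  shows "kappa n = (\<Sum>i=1..n - 2. kappa i * (fact (n - i - 2) * (n choose i)))"
proof -
  have "fb_kernel n = (\<Union>i\<in>{1..n - 2}. fb_kernel_via n i)"
  proof (intro equalityI subsetI)
    fix u assume u: "u \<in> fb_kernel n"
    then have len: "length u = n" and pos: "\<And>j. j < n \<Longrightarrow> u ! j \<in> {1..Suc j}" and g: "fb_grundy u = 0"
      by (auto simp: fb_kernel_def fb_positions_iff)
    have pre: "take l u \<in> fb_positions l" if "l \<le> n" for l
      using that len pos by (auto simp: fb_positions_iff)
    let ?S = "{i. 1 \<le> i \<and> i < n \<and> fb_grundy (take i u) = 0}"
    define i where "i = Max ?S"
    have "take 1 u = [1]"
      using len pos[of 0] assms by (cases u) auto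
    then have "1 \<in> ?S" using fb_kernel_1 assms by (auto simp: fb_kernel_def)
    moreover have fin: "finite ?S" by simp
    ultimately have i: "i \<in> ?S" unfolding i_def using Max_in by blast
    have above: "\<forall>l. i < l \<and> l < n \<longrightarrow> fb_grundy (take l u) \<noteq> 0"
    proof (intro allI impI notI)
      fix l assume "i < l \<and> l < n" "fb_grundy (take l u) = 0"
      then have "l \<in> ?S" using i by auto
      then have "l \<le> i" unfolding i_def using fin by (rule Max_ge[rotated])
      then show False using \<open>i < l \<and> l < n\<close> by simp
    qed
    then have "i + 2 \<le> n"
      using fb_last_kernel_prefix_iff[of i u] i len g by auto
    moreover have "u \<in> fb_kernel_via n i"
      using u above i pre[of i] by (auto simp: fb_kernel_via_def fb_kernel_def)
    ultimately show "u \<in> (\<Union>i\<in>{1..n - 2}. fb_kernel_via n i)" using i by force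
  qed (auto simp: fb_kernel_via_def)
  moreover have "card (\<Union>i\<in>{1..n - 2}. fb_kernel_via n i) = (\<Sum>i=1..n - 2. card (fb_kernel_via n i))"
  proof (rule card_UN_disjoint)
    show "\<forall>i\<in>{1..n - 2}. finite (fb_kernel_via n i)"
      using finite_fb_kernel by (auto simp: fb_kernel_via_def)
    \<comment> \<open>The smaller index forbids a kernel prefix of rank \<open>j\<close>, while the
      larger one requires it.\<close>
    have "fb_kernel_via n i \<inter> fb_kernel_via n j = {}" if "i < j" "j < n" for i j
      using that by (auto simp: fb_kernel_via_def fb_kernel_def)
    then show "\<forall>i\<in>{1..n - 2}. \<forall>j\<in>{1..n - 2}. i \<noteq> j \<longrightarrow> fb_kernel_via n i \<inter> fb_kernel_via n j = {}"
      using assms by (intro ballI impI) (elim linorder_neqE_nat; fastforce simp: Int_commute)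
  qed simp
  ultimately have "kappa n = (\<Sum>i=1..n - 2. card (fb_kernel_via n i))"
    by (simp add: kappa_def)
  also have "\<dots> = (\<Sum>i=1..n - 2. kappa i * (fact (n - i - 2) * (n choose i)))"
    by (rule sum.cong) (use card_fb_kernel_via card_fb_ext assms in auto)
  finally show ?thesis .
qed

section \<open>Chains and iteration of the recurrence\<close>

definition chain_weight :: "nat \<Rightarrow> nat list \<Rightarrow> nat" where
  "chain_weight k i = (\<Prod>j=0..k. fact (i ! (j + 1) - i ! j - 2) * (i ! (j + 1) choose i ! j))"

text \<open>The gaps are stated additively to avoid truncated subtraction. They make neighbours
  strictly increase, and transitivity then gives sortedness.\<close>

lemma gap2_chains_iff:
  "c \<in> gap2_chains n k \<longleftrightarrow>
     length c = k + 2 \<and> c ! 0 = 1 \<and> c ! (k + 1) = n \<and> (\<forall>j\<le>k. c ! j + 2 \<le> c ! (j + 1))"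
    (is "_ \<longleftrightarrow> ?R")
proof
  assume "c \<in> gap2_chains n k"
  then show ?R by (force simp: gap2_chains_def)
next
  assume R: ?R
  have "c ! j < c ! Suc j" if "Suc j < length c" for j
    using that R by (auto dest!: spec[of _ j])
  then have "sorted_wrt (<) c" by (simp add: sorted_wrt_iff_nth_Suc_transp)
  then show "c \<in> gap2_chains n k" using R by (force simp: gap2_chains_def)
qed

text \<open>A chain starts at 1 and makes k + 1 steps of size at least 2. This is the source of the
  upper summation limit in \<open>k\<close>.\<close>

lemma gap2_chains_length_bound:
  assumes "c \<in> gap2_chains n k"
  shows "2 * k + 3 \<le> n"
proof -
  have c: "c ! 0 = 1" "c ! (k + 1) = n" "\<And>j. j \<le> k \<Longrightarrow> c ! j + 2 \<le> c ! (j + 1)"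
    using assms by (auto simp: gap2_chains_iff)
  have "2 * j + 1 \<le> c ! j" if "j \<le> k + 1" for j
    using that
  proof (induction j)
    case (Suc j)
    then show ?case using c(3)[of j] by simp
  qed (simp add: c)
  from this[of "k + 1"] show ?thesis using c by simp
qed

lemma gap2_chains_0: "gap2_chains n 0 = (if 3 \<le> n then {[1, n]} else {})"
  by (auto simp: gap2_chains_iff length_Suc_conv)

lemma snoc_gap2_chains_iff:
  assumes "length c = k + 2"
  shows "c @ [x] \<in> gap2_chains n (Suc k) \<longleftrightarrow>
    x = n \<and> c \<in> gap2_chains (c ! (k + 1)) k \<and> c ! (k + 1) + 2 \<le> n"
proof -
  have "(\<forall>j\<le>Suc k. (c @ [x]) ! j + 2 \<le> (c @ [x]) ! (j + 1)) \<longleftrightarrow>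
      (\<forall>j\<le>k. c ! j + 2 \<le> c ! (j + 1)) \<and> c ! (k + 1) + 2 \<le> x"
    using assms by (auto simp: nth_append le_Suc_eq)
  then show ?thesis using assms by (auto simp: gap2_chains_iff nth_append)
qed

text \<open>Removing the final entry \<open>n\<close> leaves a chain ending at the penultimate entry
  \<open>i\<close>, and the weight loses exactly the factor of the last gap. The factor matches the
  one in \<open>kappa_rec\<close>.\<close>

lemma sum_chain_weight_Suc:
  "(\<Sum>c\<in>gap2_chains n (Suc k). chain_weight (Suc k) c) =
   (\<Sum>i=2..n - 2. (\<Sum>c\<in>gap2_chains i k. chain_weight k c) * (fact (n - i - 2) * (n choose i)))"
proof -
  have "(\<Sum>c\<in>gap2_chains n (Suc k). chain_weight (Suc k) c) =
      (\<Sum>(i, c)\<in>(SIGMA i:{2..n - 2}. gap2_chains i k). chain_weight (Suc k) (c @ [n]))"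
  proof (rule sum.reindex_bij_witness[of _ "\<lambda>(i, c). c @ [n]" "\<lambda>c. (c ! (k + 1), butlast c)"])
    fix c assume c: "c \<in> gap2_chains n (Suc k)"
    then have len: "length c = k + 3" by (simp add: gap2_chains_iff)
    then obtain d x where d: "c = d @ [x]" "length d = k + 2"
      by (cases c rule: rev_exhaust) auto
    have *: "x = n" "d \<in> gap2_chains (d ! (k + 1)) k" "d ! (k + 1) + 2 \<le> n"
      using c snoc_gap2_chains_iff[OF d(2)] unfolding d(1) by auto
    show "(case (c ! (k + 1), butlast c) of (i, c) \<Rightarrow> c @ [n]) = c" using d * by simp
    show "(c ! (k + 1), butlast c) \<in> (SIGMA i:{2..n - 2}. gap2_chains i k)"
      using d * gap2_chains_length_bound[OF *(2)] by (auto simp: nth_append)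
    show "(case (c ! (k + 1), butlast c) of (i, c) \<Rightarrow> chain_weight (Suc k) (c @ [n])) =
        chain_weight (Suc k) c" using d * by simp
  next
    fix p assume "p \<in> (SIGMA i:{2..n - 2}. gap2_chains i k)"
    then obtain i c where p: "p = (i, c)" "i \<in> {2..n - 2}" "c \<in> gap2_chains i k" by auto
    then have c: "length c = k + 2" "c ! (k + 1) = i" by (auto simp: gap2_chains_iff)
    show "(case p of (i, c) \<Rightarrow> c @ [n]) \<in> gap2_chains n (Suc k)"
      using p c snoc_gap2_chains_iff[OF c(1)] by auto
    show "((case p of (i, c) \<Rightarrow> c @ [n]) ! (k + 1), butlast (case p of (i, c) \<Rightarrow> c @ [n])) = p"
      using p c by (simp add: nth_append)
  qed
  also have "\<dots> = (\<Sum>i=2..n - 2. \<Sum>c\<in>gap2_chains i k. chain_weight (Suc k) (c @ [n]))"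
    by (subst sum.Sigma) (auto simp: finite_gap2_chains)
  also have "\<dots> = (\<Sum>i=2..n - 2. \<Sum>c\<in>gap2_chains i k.
      chain_weight k c * (fact (n - i - 2) * (n choose i)))"
  proof (intro sum.cong refl)
    fix i c assume "c \<in> gap2_chains i k"
    then have c: "length c = k + 2" "c ! (k + 1) = i" by (auto simp: gap2_chains_iff)
    have "chain_weight (Suc k) (c @ [n]) =
        (\<Prod>j=0..k. fact ((c @ [n]) ! (j + 1) - (c @ [n]) ! j - 2) *
          ((c @ [n]) ! (j + 1) choose (c @ [n]) ! j)) * (fact (n - i - 2) * (n choose i))"
      using c by (simp add: chain_weight_def nth_append)
    also have "(\<Prod>j=0..k. fact ((c @ [n]) ! (j + 1) - (c @ [n]) ! j - 2) *
          ((c @ [n]) ! (j + 1) choose (c @ [n]) ! j)) = chain_weight k c"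
      unfolding chain_weight_def using c by (intro prod.cong) (auto simp: nth_append)
    finally show "chain_weight (Suc k) (c @ [n]) =
        chain_weight k c * (fact (n - i - 2) * (n choose i))" .
  qed
  finally show ?thesis by (simp add: sum_distrib_right)
qed

text \<open>The added terms range over empty sets of chains. A range of \<open>k\<close> common to
  all endpoints allows the sums over \<open>k\<close> and \<open>i\<close> to be exchanged.\<close>

lemma sum_chains_extend:
  assumes "n \<le> N"
  shows "(\<Sum>k<N. \<Sum>c\<in>gap2_chains n k. chain_weight k c) =
    (\<Sum>k<n. \<Sum>c\<in>gap2_chains n k. chain_weight k c)"
proof (rule sum.mono_neutral_right)
  have "gap2_chains n k = {}" if "n \<le> k" for k
    using that gap2_chains_length_bound by fastforce
  then show "\<forall>k\<in>{..<N} - {..<n}. (\<Sum>c\<in>gap2_chains n k. chain_weight k c) = 0" by auto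
qed (use assms in auto)

lemma kappa_eq_sum_chains:
  assumes "n \<ge> 2"
  shows "kappa n = (\<Sum>k<n. \<Sum>c\<in>gap2_chains n k. chain_weight k c)"
  using assms
proof (induction n rule: less_induct)
  case (less n)
  let ?T = "\<lambda>n k. \<Sum>c\<in>gap2_chains n k. chain_weight k c"
  let ?w = "\<lambda>i. fact (n - i - 2) * (n choose i)"
  obtain N where N: "n = Suc N" using less.prems by (cases n) auto
  have "(\<Sum>k<n. ?T n k) = ?T n 0 + (\<Sum>k<N. \<Sum>i=2..n - 2. ?T i k * ?w i)"
    unfolding N sum.lessThan_Suc_shift sum_chain_weight_Suc ..
  also have "(\<Sum>k<N. \<Sum>i=2..n - 2. ?T i k * ?w i) = (\<Sum>i=2..n - 2. (\<Sum>k<N. ?T i k) * ?w i)"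
    by (subst sum.swap) (simp add: sum_distrib_right)
  also have "\<dots> = (\<Sum>i=2..n - 2. kappa i * ?w i)"
  proof (intro sum.cong refl)
    fix i assume "i \<in> {2..n - 2}"
    then have "2 \<le> i" "i < n" "i \<le> N" using N by auto
    then show "(\<Sum>k<N. ?T i k) * ?w i = kappa i * ?w i"
      using less.IH[of i] sum_chains_extend[of i N] by simp
  qed
  \<comment> \<open>The single chain \<open>[1, n]\<close> supplies the term i = 1 of the
    recurrence; for n = 2 both sides are zero.\<close>
  also have "?T n 0 + (\<Sum>i=2..n - 2. kappa i * ?w i) = (\<Sum>i=1..n - 2. kappa i * ?w i)"
  proof (cases "3 \<le> n")
    case True
    then have "?T n 0 = kappa 1 * ?w 1"
      using fb_kernel_1 by (simp add: gap2_chains_0 chain_weight_def kappa_def)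
    moreover have "(\<Sum>i=1..n - 2. kappa i * ?w i) = kappa 1 * ?w 1 + (\<Sum>i=Suc 1..n - 2. kappa i * ?w i)"
      using True by (intro sum.atLeast_Suc_atMost) simp
    ultimately show ?thesis by (simp add: numeral_2_eq_2)
  qed (simp add: gap2_chains_0)
  finally show ?case using kappa_rec[OF less.prems] by simp
qed

theorem theorem6p2:
  fixes n :: nat
  assumes "n \<ge> 2"
  shows "kappa n =
    (\<Sum>k | int k \<le> \<lfloor>(real n - 3) / 2\<rfloor>.
       \<Sum>i\<in>gap2_chains n k.
         \<Prod>j=0..k. fact (i ! (j + 1) - i ! j - 2) * (i ! (j + 1) choose i ! j))"
proof -
  \<comment> \<open>Comparing in the integers keeps the index set empty for n = 2, where the floor
    is -1.\<close>
  have bound: "int k \<le> \<lfloor>(real n - 3) / 2\<rfloor> \<longleftrightarrow> 2 * k + 3 \<le> n" for k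
  proof -
    have "int k \<le> \<lfloor>(real n - 3) / 2\<rfloor> \<longleftrightarrow> real (2 * k + 3) \<le> real n"
      by (simp add: le_floor_iff field_simps)
    then show ?thesis unfolding of_nat_le_iff .
  qed
  have "(\<Sum>k<n. \<Sum>c\<in>gap2_chains n k. chain_weight k c) =
      (\<Sum>k | 2 * k + 3 \<le> n. \<Sum>c\<in>gap2_chains n k. chain_weight k c)"
  proof (rule sum.mono_neutral_right)
    have "gap2_chains n k = {}" if "\<not> 2 * k + 3 \<le> n" for k
      using that gap2_chains_length_bound by blast
    then show "\<forall>k\<in>{..<n} - {k. 2 * k + 3 \<le> n}. (\<Sum>c\<in>gap2_chains n k. chain_weight k c) = 0"
      by auto
  qed auto
  then show ?thesis
    using kappa_eq_sum_chains[OF assms] unfolding bound chain_weight_def by simp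
qed

end
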